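(* Let $k_0, k_1 \ge 0$ be integers, not both zero, and let $K > 0$. Suppose that $\mathcal{H}$ is a non-empty $(k_0,k_1)$-uniform hypergraph on a finite vertex set $V$ and that $b$, $m$, $r$ are integers such that \[ \Delta_{(\ell_0,\ell_1)}(\mathcal{H}) \le K \cdot \frac{b^{\ell_0+\ell_1-1}}{m^{\ell_0}\cdot v(\mathcal{H})^{\ell_1}} \cdot e(\mathcal{H}) \cdot \Big(\frac{m}{r}\Big)^{\mathbb{1}[\ell_0>0]} \] for every pair $(\ell_0,\ell_1) \in \{0,\dots,k_0\}\times\{0,\dots,k_1\}$ with $(\ell_0,\ell_1)\neq(0,0)$. Let $\delta = 2^{-(k_0+k_1)(k_0+k_1+1)}K^{-1}$. Then there exist a family $\mathcal{S} \subseteq \binom{V}{\le k_0 b}\times\binom{V}{\le k_1 b}$ and functions $f\colon \mathcal{S}\to\{0,1,*\}^{V}$ and $g \colon \mathcal{F}_{\le m}(\mathcal{H}) \to \mathcal{S}$ such that: (a) every $h \in \mathcal{F}_{\le m}(\mathcal{H})$ belongs to the cylinder $f(g(h))$; (b) for every $S \in \mathcal{S}$, either $|f(S)^{-1}(0)| \ge \delta\, v(\mathcal{H})$ or $|f(S)^{-1}(1)| \ge \delta r$; moreover, the former can hold only if $k_1 > 0$ and the latter only if $k_0 > 0$; (c) if $g(h) = (S_0,S_1)$ for some $h \in \mathcal{F}_{\le m}(\mathcal{H})$, then $S_0 \subseteq h^{-1}(0)$ and $S_1 \subseteq h^{-1}(1)$.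
   Context: A $(k_0,k_1)$-uniform hypergraph $\mathcal{H}$ on a finite set $V$ is a collection (multiset; edges may have multiplicity greater than one) of pairs $(A_0,A_1)$ of disjoint subsets of $V$ with $|A_0| = k_0$ and $|A_1| = k_1$; $v(\mathcal{H}) = |V|$ and $e(\mathcal{H})$ is the number of edges counted with multiplicity. A function $h\colon V\to\{0,1\}$ violates the constraint $(A_0,A_1)$ if $h \equiv 0$ on $A_0$ and $h\equiv 1$ on $A_1$; $\mathcal{F}(\mathcal{H})$ is the set of all $h \in \{0,1\}^V$ violating no edge of $\mathcal{H}$, and $\mathcal{F}_{\le m}(\mathcal{H}) = \{h \in \mathcal{F}(\mathcal{H}) : |h^{-1}(1)| \le m\}$. For disjoint $T_0,T_1 \subseteq V$, $\deg_{\mathcal{H}}(T_0,T_1)$ is the number of edges $(A_0,A_1)$ of $\mathcal{H}$ (with multiplicity) with $T_0\subseteq A_0$ and $T_1 \subseteq A_1$, and $\Delta_{(\ell_0,\ell_1)}(\mathcal{H})$ is the maximum of $\deg_{\mathcal{H}}(T_0,T_1)$ over all $T_0,T_1\subseteq V$ with $|T_0|=\ell_0$, $|T_1|=\ell_1$. $\mathbb{1}[\ell_0>0]$ is $1$ if $\ell_0>0$ and $0$ otherwise. $\binom{V}{\le k}$ is the family of subsets of $V$ of size at most $k$. A function $a\colon V \to \{0,1,*\}$ is identified with a cylinder; $h\colon V\to\{0,1\}$ belongs to the cylinder $a$ if $h(v) = a(v)$ for every $v$ with $a(v)\neq *$.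
   Formalization: The integers b and r are additionally assumed to satisfy b ≥ 0 and r > 0; for b < 0 (when k_0+k_1 = 1) or r ≤ 0 (when k_0 = 0) the statement as written fails whenever F_{≤m}(H) is non-empty. *)

theory Defs
  imports Complex_Main "HOL-Library.Multiset" "HOL-Library.FuncSet"
begin

text \<open>
  A function on a vertex set \<open>V\<close> is an extensional HOL function, so that two functions on \<open>V\<close> are
  equal iff they agree on \<open>V\<close>.
\<close>

type_synonym 'a hyp = "('a set \<times> 'a set) multiset"

definition uniform_hypergraph :: "nat \<Rightarrow> nat \<Rightarrow> 'a set \<Rightarrow> 'a hyp \<Rightarrow> bool" where
  "uniform_hypergraph k0 k1 V H \<longleftrightarrow>
     finite V \<and>
     (\<forall>(A0, A1) \<in> set_mset H.
        A0 \<subseteq> V \<and> A1 \<subseteq> V \<and> A0 \<inter> A1 = {} \<and> card A0 = k0 \<and> card A1 = k1)"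

definition violates :: "('a \<Rightarrow> nat) \<Rightarrow> 'a set \<times> 'a set \<Rightarrow> bool" where
  "violates h A \<longleftrightarrow> (\<forall>v \<in> fst A. h v = 0) \<and> (\<forall>v \<in> snd A. h v = 1)"

definition preimage_on :: "'a set \<Rightarrow> ('a \<Rightarrow> 'b) \<Rightarrow> 'b \<Rightarrow> 'a set" where
  "preimage_on V h c = {v \<in> V. h v = c}"

definition free_funs :: "'a set \<Rightarrow> 'a hyp \<Rightarrow> ('a \<Rightarrow> nat) set" where
  "free_funs V H = {h \<in> V \<rightarrow>\<^sub>E {0, 1}. \<forall>A \<in> set_mset H. \<not> violates h A}"

definition free_funs_le :: "int \<Rightarrow> 'a set \<Rightarrow> 'a hyp \<Rightarrow> ('a \<Rightarrow> nat) set" where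
  "free_funs_le m V H = {h \<in> free_funs V H. int (card (preimage_on V h 1)) \<le> m}"

definition hdeg :: "'a hyp \<Rightarrow> 'a set \<Rightarrow> 'a set \<Rightarrow> nat" where
  "hdeg H T0 T1 = size (filter_mset (\<lambda>(A0, A1). T0 \<subseteq> A0 \<and> T1 \<subseteq> A1) H)"

text \<open>
  Pairs \<open>T0, T1\<close> that are not disjoint have degree \<open>0\<close>, as the two parts of an edge are
  disjoint. The set below is finite and, for a non-empty \<open>(k0, k1)\<close>-uniform hypergraph with
  \<open>l0 \<le> k0\<close> and \<open>l1 \<le> k1\<close>, non-empty.
\<close>

definition max_hdeg :: "nat \<Rightarrow> nat \<Rightarrow> 'a set \<Rightarrow> 'a hyp \<Rightarrow> nat" where
  "max_hdeg l0 l1 V H =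
     Max {hdeg H T0 T1 | T0 T1. T0 \<subseteq> V \<and> T1 \<subseteq> V \<and> card T0 = l0 \<and> card T1 = l1}"

definition subsets_le :: "'a set \<Rightarrow> int \<Rightarrow> 'a set set" where
  "subsets_le V k = {A. A \<subseteq> V \<and> int (card A) \<le> k}"

text \<open>In a cylinder, \<open>None\<close> plays the role of the symbol \<open>*\<close>.\<close>

definition cylinders :: "'a set \<Rightarrow> ('a \<Rightarrow> nat option) set" where
  "cylinders V = V \<rightarrow>\<^sub>E {Some 0, Some 1, None}"

definition in_cylinder :: "'a set \<Rightarrow> ('a \<Rightarrow> nat) \<Rightarrow> ('a \<Rightarrow> nat option) \<Rightarrow> bool" where
  "in_cylinder V h a \<longleftrightarrow> (\<forall>v \<in> V. a v \<noteq> None \<longrightarrow> a v = Some (h v))"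

end

theory Submission
  imports Defs
begin

text \<open>
  Encode an edge \<open>(A0, A1)\<close> as the set of literals ``\<open>v\<close> has value \<open>0\<close>'' for \<open>v \<in> A0\<close> and
  ``\<open>v\<close> has value \<open>1\<close>'' for \<open>v \<in> A1\<close>; then \<open>h\<close> violates the edge iff all its literals are true.
  For a fixed decision tree, \<open>g h\<close> is the set of queried literals true in \<open>h\<close>, and \<open>f\<close> records
  the queried literals that are false; running the tree on \<open>g h\<close> instead of \<open>h\<close> gives the same
  answers, so the false literals are a function of \<open>g h\<close>.

  The tree repeatedly queries a literal of large degree, first among the 1-literals and, once
  these are exhausted, among the 0-literals. False literals determine values of \<open>h\<close>; if only few
  are found, they meet few edges. True literals contribute their links to a hypergraph of lower
  uniformity, where edges containing a set whose link degree has become too large are discarded.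
  Large degrees exist because the edges have a small cover: all of \<open>V\<close> for 1-literals, and the at
  most \<open>m\<close> false 0-literals for edges without 1-literals. Thus after at most \<open>b\<close> positive answers
  the link hypergraph is dense enough to recurse. At uniformity one every literal is false.
\<close>

section \<open>Decision trees and their answers\<close>

datatype 'x qtree = Leaf | Query 'x "'x qtree" "'x qtree"

fun yes_set :: "'x qtree \<Rightarrow> 'x set \<Rightarrow> 'x set" where
  "yes_set Leaf X = {}"
| "yes_set (Query x t u) X = (if x \<in> X then insert x (yes_set t X) else yes_set u X)"

fun no_set :: "'x qtree \<Rightarrow> 'x set \<Rightarrow> 'x set" where
  "no_set Leaf X = {}"
| "no_set (Query x t u) X = (if x \<in> X then no_set t X else insert x (no_set u X))"

lemma yes_set_subset: "yes_set t X \<subseteq> X"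
  by (induction t) auto

lemma no_set_disjoint: "no_set t X \<inter> X = {}"
  by (induction t) simp_all

lemma finite_yes_set [simp]: "finite (yes_set t X)"
  by (induction t) simp_all

lemma finite_no_set [simp]: "finite (no_set t X)"
  by (induction t) simp_all

text \<open>Every \<open>Y\<close> between \<open>yes_set t X\<close> and \<open>X\<close> gives the
  same answers along the path. The induction needs this whole range of \<open>Y\<close>, because
  below a positive answer \<open>Y\<close> still contains the literal queried above.\<close>

lemma no_set_yes_set: "no_set t (yes_set t X) = no_set t X"
proof -
  have "no_set t Y = no_set t X" if "yes_set t X \<subseteq> Y" "Y \<subseteq> X" for Y
    using that(1)
  proof (induction t)
    case (Query x t u)
    then show ?case using that(2) by (cases "x \<in> X") auto
  qed simp
  from this[OF subset_refl yes_set_subset] show ?thesis .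
qed

text \<open>For uniformity one, where every queried literal is false: positive answers never occur,
  so their branch can be \<open>Leaf\<close>.\<close>

lemma exists_query_all:
  assumes "finite L"
  shows "\<exists>t. \<forall>X. X \<inter> L = {} \<longrightarrow> yes_set t X = {} \<and> no_set t X = L"
  using assms
proof (induction L rule: finite_induct)
  case empty
  show ?case by (intro exI[of _ Leaf]) simp
next
  case (insert x L)
  then obtain t where "\<forall>X. X \<inter> L = {} \<longrightarrow> yes_set t X = {} \<and> no_set t X = L" by blast
  then show ?case by (intro exI[of _ "Query x Leaf t"]) auto
qed

section \<open>Literals, sizes and degrees\<close>

text \<open>A literal \<open>(v, c)\<close> asserts that \<open>v\<close> has value \<open>1\<close> if \<open>c\<close> holds and value \<open>0\<close> otherwise.\<close>

definition sz :: "bool \<Rightarrow> ('a \<times> bool) set \<Rightarrow> nat" where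
  "sz c T = card {x \<in> T. snd x = c}"

text \<open>Edges are indexed by \<open>I\<close>, so that repeated edges, and links that coincide
  after a literal is removed, are counted separately.\<close>

definition deg :: "'i set \<Rightarrow> ('i \<Rightarrow> 'x set) \<Rightarrow> 'x set \<Rightarrow> nat" where
  "deg I E T = card {i \<in> I. T \<subseteq> E i}"

lemma sz_mono: "finite B \<Longrightarrow> A \<subseteq> B \<Longrightarrow> sz c A \<le> sz c B"
  unfolding sz_def by (rule card_mono) auto

lemma sz_insert:
  assumes "finite T" "u \<notin> T"
  shows "sz c (insert u T) = sz c T + (if snd u = c then 1 else 0)"
proof -
  have "{x \<in> insert u T. snd x = c} = (if snd u = c then insert u {x \<in> T. snd x = c} else {x \<in> T. snd x = c})"
    by auto
  then show ?thesis using assms unfolding sz_def by simp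
qed

lemma sz_insert_le:
  assumes "finite T"
  shows "sz c (insert u T) \<le> sz c T + (if snd u = c then 1 else 0)"
  by (cases "u \<in> T") (simp_all add: insert_absorb sz_insert assms)

lemma card_eq_sz:
  assumes "finite T"
  shows "card T = sz False T + sz True T"
proof -
  have "T = {x \<in> T. snd x = False} \<union> {x \<in> T. snd x = True}" by auto
  then have "card T = card ({x \<in> T. snd x = False} \<union> {x \<in> T. snd x = True})" by simp
  also have "\<dots> = sz False T + sz True T"
    unfolding sz_def by (rule card_Un_disjoint) (use assms in auto)
  finally show ?thesis .
qed

lemma sz_eq_card: "Z \<subseteq> UNIV \<times> {c} \<Longrightarrow> sz c Z = card Z"
  unfolding sz_def by (rule arg_cong[of _ _ card]) auto

lemma deg_mono: "finite I \<Longrightarrow> J \<subseteq> I \<Longrightarrow> (\<And>i. i \<in> J \<Longrightarrow> E' i \<subseteq> E i) \<Longrightarrow> deg J E' T \<le> deg I E T"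
  unfolding deg_def by (rule card_mono) auto

lemma card_le_sum_deg:
  assumes "finite I" "finite N" "B \<subseteq> I" "\<And>i. i \<in> B \<Longrightarrow> \<exists>T\<in>N. T \<subseteq> E i"
  shows "card B \<le> (\<Sum>T\<in>N. deg I E T)"
proof -
  have "B \<subseteq> (\<Union>T\<in>N. {i \<in> I. T \<subseteq> E i})" using assms by auto
  then have "card B \<le> card (\<Union>T\<in>N. {i \<in> I. T \<subseteq> E i})"
    using assms by (intro card_mono) auto
  also have "\<dots> \<le> (\<Sum>T\<in>N. card {i \<in> I. T \<subseteq> E i})" by (rule card_UN_le[OF assms(2)])
  finally show ?thesis unfolding deg_def .
qed

lemma card_le_sum_deg_singleton:
  assumes "finite I" "finite N" "B \<subseteq> I" "\<And>i. i \<in> B \<Longrightarrow> E i \<inter> N \<noteq> {}"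
  shows "card B \<le> (\<Sum>x\<in>N. deg I E {x})"
proof -
  have "card B \<le> (\<Sum>T\<in>(\<lambda>x. {x}) ` N. deg I E T)"
    by (rule card_le_sum_deg) (use assms in auto)
  also have "\<dots> = (\<Sum>x\<in>N. deg I E {x})"
    by (subst sum.reindex) (auto simp: inj_on_def)
  finally show ?thesis .
qed

text \<open>Double counting: each edge has only \<open>2 ^ n - 1\<close> non-empty subsets.\<close>

lemma sum_deg_le:
  assumes "finite I" "finite N" "\<And>i. i \<in> I \<Longrightarrow> finite (E i) \<and> card (E i) = n" "{} \<notin> N"
  shows "(\<Sum>T\<in>N. deg I E T) \<le> card I * (2 ^ n - 1)"
proof -
  have "(\<Sum>T\<in>N. deg I E T) = (\<Sum>T\<in>N. \<Sum>i\<in>I. if T \<subseteq> E i then 1 else 0)"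
    unfolding deg_def by (intro sum.cong refl) (simp add: sum.If_cases assms Int_def)
  also have "\<dots> = (\<Sum>i\<in>I. \<Sum>T\<in>N. if T \<subseteq> E i then 1 else 0)" by (rule sum.swap)
  also have "\<dots> = (\<Sum>i\<in>I. card {T \<in> N. T \<subseteq> E i})"
    by (intro sum.cong refl) (simp add: sum.If_cases assms Int_def)
  also have "\<dots> \<le> (\<Sum>i\<in>I. 2 ^ n - 1)"
  proof (rule sum_mono)
    fix i assume i: "i \<in> I"
    have "card {T \<in> N. T \<subseteq> E i} \<le> card (Pow (E i) - {{}})"
      using assms i by (intro card_mono) auto
    also have "\<dots> = 2 ^ n - 1" using assms(3)[OF i] by (simp add: card_Diff_singleton card_Pow)
    finally show "card {T \<in> N. T \<subseteq> E i} \<le> 2 ^ n - 1" .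
  qed
  finally show ?thesis by simp
qed

section \<open>Weights, balanced hypergraphs and uniformity one\<close>

locale container =
  fixes V :: "'a set" and b m r :: nat and \<delta> :: real
  assumes finite_V: "finite V" and card_V: "card V > 0" and m_pos: "m > 0" and r_pos: "r > 0"
    and \<delta>_pos: "\<delta> > 0"
begin

text \<open>Bounds the size of a set of literals of side \<open>c\<close> that meets every edge; see
  \<open>exists_popular\<close>.\<close>

definition cover_size :: "bool \<Rightarrow> real" where
  "cover_size c = (if c then real (card V) else real m)"

text \<open>The yardstick of (b): a false 1-literal fixes the value 0 and is measured against
  \<open>v(H)\<close>, a false 0-literal fixes the value 1 and is measured against
  \<open>r\<close>.\<close>

definition scale :: "bool \<Rightarrow> real" where
  "scale c = (if c then real (card V) else real r)"

text \<open>The factor of \<open>K * e(H)\<close> in the degree hypothesis, with one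
  \<open>m\<close> cancelled against \<open>m / r\<close> when a 0-literal is present. Without
  0-literals neither \<open>m\<close> nor \<open>r\<close> enters.\<close>

definition wt :: "('a \<times> bool) set \<Rightarrow> real" where
  "wt T = real b ^ (sz False T + sz True T - 1) /
     (real m ^ (sz False T - 1) * real (card V) ^ sz True T * (if sz False T > 0 then real r else 1))"

text \<open>When \<open>X\<close> is the set of true literals of \<open>h\<close>, the false
  0-literals \<open>V \<times> {False} - X\<close> mark the vertices of value 1.\<close>

definition free :: "'i set \<Rightarrow> ('i \<Rightarrow> ('a \<times> bool) set) \<Rightarrow> ('a \<times> bool) set \<Rightarrow> bool" where
  "free I E X \<longleftrightarrow> card (V \<times> {False} - X) \<le> m \<and> (\<forall>i\<in>I. \<not> E i \<subseteq> X)"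

definition good :: "(bool \<Rightarrow> nat) \<Rightarrow> ('a \<times> bool) qtree \<Rightarrow> ('a \<times> bool) set \<Rightarrow> bool" where
  "good \<kappa> t X \<longleftrightarrow> no_set t X \<subseteq> V \<times> UNIV \<and> (\<forall>c. sz c (yes_set t X) \<le> \<kappa> c * b) \<and>
     (\<exists>c. \<kappa> c > 0 \<and> \<delta> * scale c \<le> real (sz c (no_set t X)))"

text \<open>The parameter \<open>W\<close> absorbs \<open>K\<close>, the number of edges and the factors lost while lowering
  the uniformity.\<close>

definition balanced :: "(bool \<Rightarrow> nat) \<Rightarrow> real \<Rightarrow> 'i set \<Rightarrow> ('i \<Rightarrow> ('a \<times> bool) set) \<Rightarrow> bool" where
  "balanced \<kappa> W I E \<longleftrightarrow> finite I \<and> I \<noteq> {} \<and> (\<forall>i\<in>I. E i \<subseteq> V \<times> UNIV \<and> (\<forall>c. sz c (E i) = \<kappa> c)) \<and>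
     W > 0 \<and> (\<forall>T. T \<noteq> {} \<longrightarrow> real (deg I E T) \<le> W * wt T) \<and>
     \<delta> * 2 ^ ((\<kappa> False + \<kappa> True) * (\<kappa> False + \<kappa> True + 1)) * W \<le> real (card I)"

lemma balancedD:
  assumes "balanced \<kappa> W I E"
  shows "finite I" "I \<noteq> {}" "i \<in> I \<Longrightarrow> E i \<subseteq> V \<times> UNIV" "i \<in> I \<Longrightarrow> sz c (E i) = \<kappa> c" "W > 0"
    "T \<noteq> {} \<Longrightarrow> real (deg I E T) \<le> W * wt T"
    "\<delta> * 2 ^ ((\<kappa> False + \<kappa> True) * (\<kappa> False + \<kappa> True + 1)) * W \<le> real (card I)"
  using assms unfolding balanced_def by simp_all

lemma cover_size_pos: "cover_size c > 0"
  using card_V m_pos by (simp add: cover_size_def)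

lemma scale_pos: "scale c > 0"
  using card_V r_pos by (simp add: scale_def)

lemma wt_nonneg: "wt T \<ge> 0"
  unfolding wt_def by simp

lemma wt_pos: "b > 0 \<Longrightarrow> wt T > 0"
  unfolding wt_def using card_V m_pos r_pos by simp

text \<open>With the degree bound of \<open>balanced\<close>, each literal of side \<open>c\<close>
  lies in at most \<open>W / scale c\<close> edges, so fewer than \<open>\<delta> * scale c\<close>
  false literals meet at most \<open>\<delta> * W\<close> edges.\<close>

lemma wt_singleton: "wt {u} = 1 / scale (snd u)"
proof -
  have "sz c {u} = (if snd u = c then 1 else 0)" for c
    using sz_insert[of "{}" u c] by (simp add: sz_def)
  then show ?thesis by (simp add: wt_def scale_def)
qed

text \<open>This is why 1-literals are treated first. Adding a first 0-literal to a set of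
  1-literals would cost a factor \<open>b / r\<close>; only further ones cost \<open>b / m\<close>.
  The last hypothesis ensures, \<open>T\<close> being non-empty, that a new 0-literal finds another
  one in \<open>T\<close>.\<close>

lemma wt_insert:
  assumes "finite T" "u \<notin> T" "T \<noteq> {}" "snd u \<or> sz True T = 0"
  shows "wt (insert u T) = wt T * (real b / cover_size (snd u))"
proof -
  have "card T > 0" using assms by (simp add: card_gt_0_iff)
  then have n: "sz False T + sz True T > 0" using card_eq_sz[OF assms(1)] by simp
  then obtain n where n': "sz False T + sz True T = Suc n" by (cases "sz False T + sz True T") auto
  show ?thesis
  proof (cases "snd u")
    case True
    then show ?thesis using n'
      by (simp add: wt_def sz_insert assms cover_size_def mult_ac)
  next
    case False
    then obtain l where "sz False T = Suc l" "sz True T = 0" using assms n by (cases "sz False T") auto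
    then show ?thesis using False
      by (simp add: wt_def sz_insert assms cover_size_def mult_ac)
  qed
qed

text \<open>All edges are singletons of one side \<open>c\<close>, and each literal lies in at most
  \<open>W / scale c\<close> of them, so their union \<open>L\<close> has at least
  \<open>\<delta> * scale c\<close> elements. Since \<open>X\<close> contains no edge, all of
  \<open>L\<close> is false, and it suffices to query \<open>L\<close>.\<close>

lemma balanced_base:
  assumes "balanced \<kappa> W I E" "\<kappa> False + \<kappa> True = 1"
  shows "\<exists>t. \<forall>X. free I E X \<longrightarrow> good \<kappa> t X"
proof -
  note bal = balancedD[OF assms(1)]
  obtain c where c: "\<kappa> c = 1" "\<kappa> (\<not> c) = 0"
  proof (cases "\<kappa> True = 1")
    case True
    then show ?thesis using that[of True] assms(2) by simp
  next
    case False
    then show ?thesis using that[of False] assms(2) by simp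
  qed
  define L where "L = (\<Union>i\<in>I. E i)"
  have fin: "finite (E i)" if "i \<in> I" for i
    by (rule finite_subset[OF bal(3)[OF that]]) (simp add: finite_V)
  then have finL: "finite L" unfolding L_def using bal(1) by blast
  have single: "\<exists>u. E i = {u} \<and> snd u = c" if i: "i \<in> I" for i
  proof -
    have "card (E i) = 1" using card_eq_sz[OF fin[OF i]] bal(4)[OF i] assms(2) by simp
    then obtain u where u: "E i = {u}" by (auto simp: card_1_singleton_iff)
    have "sz c (E i) = 1" using bal(4)[OF i] c by simp
    then have "snd u = c" using u sz_insert[of "{}" u c] by (simp add: sz_def split: if_splits)
    then show ?thesis using u by blast
  qed
  have sideL: "snd u = c" if "u \<in> L" for u using that single unfolding L_def by fastforce
  have "real (card I) \<le> real (\<Sum>u\<in>L. deg I E {u})"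
    unfolding of_nat_le_iff
    by (rule card_le_sum_deg_singleton) (use bal(1) finL single in \<open>fastforce simp: L_def\<close>)+
  also have "\<dots> = (\<Sum>u\<in>L. real (deg I E {u}))" by simp
  also have "\<dots> \<le> (\<Sum>u\<in>L. W / scale c)"
  proof (rule sum_mono)
    fix u assume "u \<in> L"
    then show "real (deg I E {u}) \<le> W / scale c" using bal(6)[of "{u}"] wt_singleton[of u] sideL[of u] by simp
  qed
  also have "\<dots> = real (card L) * W / scale c" by simp
  finally have 1: "real (card I) * scale c \<le> real (card L) * W"
    using scale_pos[of c] by (simp add: field_simps)
  have "\<delta> * W \<le> real (card I)"
  proof -
    \<comment> \<open>At uniformity one the constant in \<open>balanced\<close> is
      \<open>2 ^ (1 * 2) = 4\<close>.\<close>
    have "\<delta> * W * 1 \<le> \<delta> * W * 4" using bal(5) \<delta>_pos by (intro mult_left_mono) auto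
    also have "\<dots> \<le> real (card I)" using bal(7) assms(2) by (simp add: mult_ac)
    finally show ?thesis by simp
  qed
  then have "\<delta> * W * scale c \<le> real (card I) * scale c"
    using scale_pos[of c] by (intro mult_right_mono) auto
  with 1 have "(\<delta> * scale c) * W \<le> real (card L) * W" by (simp add: mult_ac)
  then have big: "\<delta> * scale c \<le> real (card L)" using bal(5) by simp
  have szL: "sz c L = card L" using sideL by (intro sz_eq_card) auto
  obtain t where t: "\<And>X. X \<inter> L = {} \<Longrightarrow> yes_set t X = {} \<and> no_set t X = L"
    using exists_query_all[OF finL] by blast
  have "good \<kappa> t X" if "free I E X" for X
  proof -
    have "X \<inter> L = {}" using that single unfolding free_def L_def by fastforce
    then have yn: "yes_set t X = {}" "no_set t X = L" using t by auto
    have "L \<subseteq> V \<times> UNIV" unfolding L_def using bal(3) by blast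
    then show ?thesis unfolding good_def yn using big szL c(1)
      by (intro conjI exI[of _ c]) (auto simp: sz_def)
  qed
  then show ?thesis by blast
qed

end

section \<open>One phase: collecting links, of uniformity smaller by one\<close>

locale phase = container V b m r \<delta> for V :: "'a set" and b m r :: nat and \<delta> :: real +
  fixes I :: "'i set" and E :: "'i \<Rightarrow> ('a \<times> bool) set" and \<kappa> :: "bool \<Rightarrow> nat" and W :: real
    and c :: bool
  assumes bal: "balanced \<kappa> W I E" and \<kappa>_pos: "\<kappa> c > 0" and side: "c \<or> \<kappa> True = 0"
    and b_pos: "b > 0" and two_le: "2 \<le> \<kappa> False + \<kappa> True"
begin

definition s :: nat where "s = \<kappa> False + \<kappa> True"

text \<open>Each positive answer collects at least \<open>card I / (2 * cover_size c)\<close> links,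
  so \<open>b\<close> of them collect at least a fraction \<open>p / 2\<close>. The same quotient is
  the factor in \<open>wt_insert\<close>. The cap at 1 is for large \<open>b\<close>, where the
  degrees of links are bounded by those of \<open>E\<close>.\<close>

definition p :: real where "p = min 1 (real b / cover_size c)"

text \<open>Half of the degree allowed in \<open>state\<close>; the other half leaves room for the
  links added by one positive answer.\<close>

definition heavy :: "'i set \<Rightarrow> ('i \<Rightarrow> 'a \<times> bool) \<Rightarrow> ('a \<times> bool) set \<Rightarrow> bool" where
  "heavy J q T \<longleftrightarrow> T \<noteq> {} \<and> p * W * wt T \<le> real (deg J (\<lambda>i. E i - {q i}) T)"

text \<open>\<open>A\<close> holds the edges still available, \<open>J\<close> those whose link \<open>E i - {q i}\<close> has been collected,
  \<open>y\<close> counts the positive answers and \<open>Z\<close> the literals found to be false.\<close>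

definition state :: "'i set \<Rightarrow> 'i set \<Rightarrow> ('i \<Rightarrow> 'a \<times> bool) \<Rightarrow> nat \<Rightarrow> ('a \<times> bool) set \<Rightarrow> bool" where
  "state A J q y Z \<longleftrightarrow> A \<subseteq> I \<and> J \<subseteq> I \<and> A \<inter> J = {} \<and> Z \<subseteq> V \<times> {c} \<and>
     (\<forall>i\<in>J. q i \<in> E i \<and> snd (q i) = c) \<and>
     (\<forall>i\<in>A. \<forall>T. heavy J q T \<longrightarrow> \<not> T \<subseteq> E i) \<and>
     (\<forall>i\<in>I - A - J. E i \<inter> Z \<noteq> {} \<or> (\<exists>T. heavy J q T \<and> T \<subseteq> E i)) \<and>
     (\<forall>T. T \<noteq> {} \<longrightarrow> real (deg J (\<lambda>i. E i - {q i}) T) \<le> 2 * p * W * wt T) \<and>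
     real y * real (card I) \<le> 2 * cover_size c * real (card J)"

lemma stateD:
  assumes "state A J q y Z"
  shows "A \<subseteq> I" "J \<subseteq> I" "A \<inter> J = {}" "Z \<subseteq> V \<times> {c}"
    "i \<in> J \<Longrightarrow> q i \<in> E i" "i \<in> J \<Longrightarrow> snd (q i) = c"
    "i \<in> A \<Longrightarrow> heavy J q T \<Longrightarrow> \<not> T \<subseteq> E i"
    "i \<in> I \<Longrightarrow> i \<notin> A \<Longrightarrow> i \<notin> J \<Longrightarrow> E i \<inter> Z \<noteq> {} \<or> (\<exists>T. heavy J q T \<and> T \<subseteq> E i)"
    "T \<noteq> {} \<Longrightarrow> real (deg J (\<lambda>i. E i - {q i}) T) \<le> 2 * p * W * wt T"
    "real y * real (card I) \<le> 2 * cover_size c * real (card J)"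
  using assms unfolding state_def by simp_all

lemma finite_I: "finite I" and I_ne: "I \<noteq> {}" and E_sub: "i \<in> I \<Longrightarrow> E i \<subseteq> V \<times> UNIV"
  and sz_E: "i \<in> I \<Longrightarrow> sz c' (E i) = \<kappa> c'" and W_pos: "W > 0"
  and deg_le: "T \<noteq> {} \<Longrightarrow> real (deg I E T) \<le> W * wt T"
  and large: "\<delta> * 2 ^ (s * (s + 1)) * W \<le> real (card I)"
  using balancedD[OF bal] unfolding s_def by simp_all

lemma card_I: "card I > 0"
  using finite_I I_ne by (simp add: card_gt_0_iff)

lemma s_ge: "s \<ge> 2"
  using two_le s_def by simp

lemma p_pos: "p > 0" and p_le_1: "p \<le> 1" and p_le: "p \<le> real b / cover_size c"
  unfolding p_def using b_pos cover_size_pos[of c] by auto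

lemma finite_E: "i \<in> I \<Longrightarrow> finite (E i)"
  by (rule finite_subset[OF E_sub]) (simp_all add: finite_V)

lemma card_E: "i \<in> I \<Longrightarrow> card (E i) = s"
  using card_eq_sz[OF finite_E] sz_E s_def by simp

text \<open>An edge outside \<open>A\<close> is collected in \<open>J\<close>, meets
  \<open>Z\<close>, or contains a heavy set. The second kind makes up at most a quarter of
  \<open>I\<close>, the first and third together at most another quarter.\<close>

lemma available_large:
  assumes st: "state A J q y Z" and J: "real (card J) < p * real (card I) / 2 ^ (s + 1)"
    and Z: "real (card Z) < \<delta> * scale c"
  shows "real (card I) \<le> 2 * real (card A)"
proof -
  note st = stateD[OF st]
  let ?E = "\<lambda>i. E i - {q i}"
  define N where "N = {T. heavy J q T}"
  have finJ: "finite J" and finZ: "finite Z"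
    using finite_subset[OF st(2) finite_I] finite_subset[OF st(4)] finite_V by auto
  \<comment> \<open>Weights are positive because \<open>b > 0\<close>, so a heavy set lies in some
    collected edge; hence there are finitely many.\<close>
  have N_sub: "N \<subseteq> (\<Union>i\<in>J. Pow (E i))"
  proof
    fix T assume "T \<in> N"
    then have "p * W * wt T \<le> real (deg J ?E T)" unfolding N_def heavy_def by simp
    moreover have "p * W * wt T > 0" using p_pos W_pos wt_pos[OF b_pos] by simp
    ultimately have "deg J ?E T \<noteq> 0" by linarith
    then have "{i \<in> J. T \<subseteq> ?E i} \<noteq> {}" unfolding deg_def by (metis card.empty)
    then show "T \<in> (\<Union>i\<in>J. Pow (E i))" by auto
  qed
  have "finite (\<Union>i\<in>J. Pow (E i))" using finJ st(2) finite_E by auto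
  then have finN: "finite N" using N_sub finite_subset by blast
  define B1 where "B1 = {i \<in> I. E i \<inter> Z \<noteq> {}}"
  define B2 where "B2 = {i \<in> I. \<exists>T\<in>N. T \<subseteq> E i}"
  have "I \<subseteq> A \<union> J \<union> B1 \<union> B2" using st(8) unfolding B1_def B2_def N_def by blast
  then have "card I \<le> card (A \<union> J \<union> B1 \<union> B2)"
    using finite_subset[OF st(1) finite_I] finJ finite_I by (intro card_mono) (auto simp: B1_def B2_def)
  also have "\<dots> \<le> card A + card J + card B1 + card B2"
    by (meson add_le_mono card_Un_le le_refl le_trans)
  finally have split: "real (card I) \<le> real (card A) + real (card J) + real (card B1) + real (card B2)"
    by linarith

  have "real (card B1) \<le> real (\<Sum>u\<in>Z. deg I E {u})"
    unfolding of_nat_le_iff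
    by (rule card_le_sum_deg_singleton) (use finite_I finZ in \<open>auto simp: B1_def\<close>)
  also have "\<dots> = (\<Sum>u\<in>Z. real (deg I E {u}))" by simp
  also have "\<dots> \<le> (\<Sum>u\<in>Z. W / scale c)"
  proof (rule sum_mono)
    fix u assume "u \<in> Z"
    then have "snd u = c" using st(4) by auto
    then show "real (deg I E {u}) \<le> W / scale c" using deg_le[of "{u}"] wt_singleton[of u] by simp
  qed
  also have "\<dots> = real (card Z) * (W / scale c)" by simp
  also have "\<dots> \<le> \<delta> * scale c * (W / scale c)"
    using Z W_pos scale_pos[of c] by (intro mult_right_mono) auto
  also have "\<dots> = \<delta> * W" using scale_pos[of c] by simp
  finally have B1: "real (card B1) \<le> \<delta> * W" .
  have "(2::real) ^ 2 \<le> 2 ^ (s * (s + 1))" using s_ge by (intro power_increasing) (auto simp: le_Suc_eq)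
  then have "\<delta> * W * 4 \<le> \<delta> * W * 2 ^ (s * (s + 1))" using \<delta>_pos W_pos by (intro mult_left_mono) auto
  also have "\<dots> \<le> real (card I)" using large by (simp add: mult_ac)
  finally have B1': "4 * real (card B1) \<le> real (card I)" using B1 by simp

  \<comment> \<open>The degree of a heavy set in \<open>E\<close> is at most \<open>1 / p\<close>
    times its degree among the links, and the latter degrees are summed by double counting over
    links of size \<open>s - 1\<close>.\<close>
  have "real (card B2) \<le> real (\<Sum>T\<in>N. deg I E T)"
    unfolding of_nat_le_iff
    by (rule card_le_sum_deg) (use finite_I finN in \<open>auto simp: B2_def\<close>)
  also have "\<dots> = (\<Sum>T\<in>N. real (deg I E T))" by simp
  also have "\<dots> \<le> (\<Sum>T\<in>N. real (deg J ?E T) / p)"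
  proof (rule sum_mono)
    fix T assume "T \<in> N"
    then have "T \<noteq> {}" and h: "p * W * wt T \<le> real (deg J ?E T)" unfolding N_def heavy_def by auto
    then have "real (deg I E T) \<le> W * wt T" using deg_le by simp
    also have "\<dots> \<le> real (deg J ?E T) / p" using h p_pos by (simp add: field_simps)
    finally show "real (deg I E T) \<le> real (deg J ?E T) / p" .
  qed
  also have "\<dots> = real (\<Sum>T\<in>N. deg J ?E T) / p" by (simp add: sum_divide_distrib)
  also have "\<dots> \<le> real (card J * (2 ^ (s - 1) - 1)) / p"
  proof (rule divide_right_mono)
    have "(\<Sum>T\<in>N. deg J ?E T) \<le> card J * (2 ^ (s - 1) - 1)"
    proof (rule sum_deg_le[OF finJ finN])
      fix i assume "i \<in> J"
      then show "finite (?E i) \<and> card (?E i) = s - 1"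
        using st(2,5) finite_E card_E by (auto simp: card_Diff_singleton)
    qed (simp add: N_def heavy_def)
    then show "real (\<Sum>T\<in>N. deg J ?E T) \<le> real (card J * (2 ^ (s - 1) - 1))"
      using of_nat_le_iff by blast
  qed (use p_pos in simp)
  also have "\<dots> = real (card J) / p * (2 ^ (s - 1) - 1)" by (simp add: of_nat_diff)
  finally have B2: "real (card B2) \<le> real (card J) / p * (2 ^ (s - 1) - 1)" .
  \<comment> \<open>The \<open>- 1\<close> from excluding the empty set pays for \<open>J\<close>
    itself.\<close>
  have "real (card J) \<le> real (card J) / p" using p_pos p_le_1 by (simp add: le_divide_eq mult_left_le)
  then have "real (card J) + real (card B2) \<le> real (card J) / p * 2 ^ (s - 1)"
    using B2 by (simp add: algebra_simps)
  also have "\<dots> \<le> real (card I) / 2 ^ (s + 1) * 2 ^ (s - 1)"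
  proof (rule mult_right_mono)
    show "real (card J) / p \<le> real (card I) / 2 ^ (s + 1)"
      using J p_pos by (simp add: field_simps)
  qed simp
  also have "\<dots> = real (card I) / 4"
  proof -
    obtain n where "s = Suc n" using s_ge by (cases s) auto
    then show ?thesis by simp
  qed
  finally show ?thesis using split B1' by linarith
qed

text \<open>Pigeonhole over a small cover \<open>N\<close> of the edges. \<open>X\<close> serves
  only to exhibit the cover; the conclusion does not mention it, so the same query can be made for
  all sets.\<close>

lemma exists_popular:
  assumes "free I E X" "A \<subseteq> I" "A \<noteq> {}"
  shows "\<exists>u\<in>V \<times> {c}. real (card A) \<le> cover_size c * real (deg A E {u})"
proof -
  obtain N where N: "N \<subseteq> V \<times> {c}" "real (card N) \<le> cover_size c" "\<And>i. i \<in> I \<Longrightarrow> E i \<inter> N \<noteq> {}"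
  proof (cases c)
    case True
    show ?thesis
    proof (rule that[of "V \<times> {c}"])
      show "real (card (V \<times> {c})) \<le> cover_size c" using True by (simp add: cover_size_def card_cartesian_product)
      fix i assume i: "i \<in> I"
      have "sz c (E i) \<noteq> 0" using sz_E[OF i] \<kappa>_pos by simp
      then have "{x \<in> E i. snd x = c} \<noteq> {}" unfolding sz_def by (metis card.empty)
      then show "E i \<inter> V \<times> {c} \<noteq> {}" using E_sub[OF i] by fastforce
    qed simp
  next
    case False
    show ?thesis
    proof (rule that[of "V \<times> {False} - X"])
      show "real (card (V \<times> {False} - X)) \<le> cover_size c"
        using False assms(1) by (simp add: cover_size_def free_def)
      fix i assume i: "i \<in> I"
      have "sz True (E i) = 0" using sz_E[OF i] side False by simp
      then have "{x \<in> E i. snd x = True} = {}" unfolding sz_def using finite_E[OF i] by simp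
      then have "E i \<subseteq> V \<times> {False}" using E_sub[OF i] by fastforce
      moreover have "\<not> E i \<subseteq> X" using assms(1) i by (simp add: free_def)
      ultimately show "E i \<inter> (V \<times> {False} - X) \<noteq> {}" by blast
    qed (use False in auto)
  qed
  have finN: "finite N" using N(1) finite_V by (auto intro: finite_subset)
  have finA: "finite A" using assms(2) finite_I finite_subset by blast
  have "N \<noteq> {}" using N(3) assms by blast
  have "\<exists>u\<in>N. \<forall>w\<in>N. deg A E {w} \<le> deg A E {u}"
  proof -
    have "Max ((\<lambda>u. deg A E {u}) ` N) \<in> (\<lambda>u. deg A E {u}) ` N" using finN \<open>N \<noteq> {}\<close> by (intro Max_in) auto
    then obtain u where u: "u \<in> N" "deg A E {u} = Max ((\<lambda>u. deg A E {u}) ` N)" by (metis (no_types, lifting) imageE)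
    then show ?thesis using finN by (intro bexI[of _ u]) auto
  qed
  then obtain u where u: "u \<in> N" "\<And>w. w \<in> N \<Longrightarrow> deg A E {w} \<le> deg A E {u}" by blast
  have "card A \<le> (\<Sum>w\<in>N. deg A E {w})"
    by (rule card_le_sum_deg_singleton) (use finA finN N(3) assms(2) in auto)
  also have "\<dots> \<le> card N * deg A E {u}" using u(2) sum_bounded_above[of N "\<lambda>w. deg A E {w}"] by simp
  finally have "real (card A) \<le> real (card N) * real (deg A E {u})" by (metis of_nat_le_iff of_nat_mult)
  also have "\<dots> \<le> cover_size c * real (deg A E {u})" using N(2) by (intro mult_right_mono) auto
  finally show ?thesis using u(1) N(1) by blast
qed

lemma state_no:
  assumes st: "state A J q y Z" and u: "u \<in> V \<times> {c}"
  shows "state {i \<in> A. u \<notin> E i} J q y (insert u Z)"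
proof -
  note st = stateD[OF st]
  have "E i \<inter> insert u Z \<noteq> {} \<or> (\<exists>T. heavy J q T \<and> T \<subseteq> E i)"
    if "i \<in> I - {i \<in> A. u \<notin> E i} - J" for i
    using that st(8)[of i] by blast
  then show ?thesis unfolding state_def using st(1-7,9,10) u by auto
qed

text \<open>A set \<open>T\<close> inside a new link lies in an available edge, hence was not heavy.
  Its degree grows by at most the degree of \<open>insert u T\<close> in \<open>E\<close>, which for
  \<open>p < 1\<close> is at most \<open>p * W * wt T\<close> by \<open>wt_insert\<close>; the two
  halves add up to the bound in \<open>state\<close>.\<close>

lemma state_yes:
  assumes st: "state A J q y Z" and u: "u \<in> V \<times> {c}"
    and pop: "real (card A) \<le> cover_size c * real (deg A E {u})"
    and A: "real (card I) \<le> 2 * real (card A)"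
  defines "B \<equiv> {i \<in> A. u \<in> E i}"
  defines "q' \<equiv> \<lambda>i. if i \<in> B then u else q i"
  shows "state {i \<in> A. u \<notin> E i \<and> (\<forall>T. heavy (J \<union> B) q' T \<longrightarrow> \<not> T \<subseteq> E i)} (J \<union> B) q' (Suc y) Z"
proof -
  note st = stateD[OF st]
  let ?E = "\<lambda>i. E i - {q i}" and ?E' = "\<lambda>i. E i - {q' i}"
  have fin: "finite A" "finite J" "finite B" using st(1,2) finite_I unfolding B_def by (auto intro: finite_subset)
  have disj: "J \<inter> B = {}" using st(3) unfolding B_def by auto
  have sub: "J \<union> B \<subseteq> I" using st(1,2) unfolding B_def by auto
  have deg': "deg (J \<union> B) ?E' T = deg J ?E T + card {i \<in> B. T \<subseteq> E i - {u}}" for T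
  proof -
    have "{i \<in> J \<union> B. T \<subseteq> ?E' i} = {i \<in> J. T \<subseteq> ?E i} \<union> {i \<in> B. T \<subseteq> E i - {u}}"
      using disj unfolding q'_def by auto
    then show ?thesis unfolding deg_def using fin disj by (simp only:) (subst card_Un_disjoint, auto)
  qed
  \<comment> \<open>Degrees of links only grow, so edges discarded earlier still contain a heavy
    set.\<close>
  have heavy_mono: "heavy (J \<union> B) q' T" if "heavy J q T" for T
    using that unfolding heavy_def deg' by auto
  have bound: "real (deg (J \<union> B) ?E' T) \<le> 2 * p * W * wt T" if T: "T \<noteq> {}" for T
  proof (cases "{i \<in> B. T \<subseteq> E i - {u}} = {}")
    case True
    then show ?thesis using st(9)[OF T] unfolding deg' True by simp
  next
    case False
    then obtain i where i: "i \<in> A" "T \<subseteq> E i" "u \<notin> T" unfolding B_def by blast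
    then have iI: "i \<in> I" using st(1) by auto
    have finT: "finite T" using i(2) finite_E[OF iI] finite_subset by blast
    show ?thesis
    proof (cases "real b / cover_size c < 1")
      case True
      then have p: "p = real b / cover_size c" unfolding p_def by simp
      have "sz True T = 0" if "\<not> c"
        using sz_mono[OF finite_E[OF iI] i(2), of True] sz_E[OF iI] side that by simp
      then have w: "wt (insert u T) = wt T * p"
        using wt_insert[OF finT i(3) T] u p by (cases c) auto
      have "\<not> heavy J q T" using st(7) i by blast
      then have 1: "real (deg J ?E T) \<le> p * W * wt T" using T unfolding heavy_def by simp
      have "card {i \<in> B. T \<subseteq> E i - {u}} \<le> deg I E (insert u T)"
        unfolding deg_def using finite_I sub by (intro card_mono) (auto simp: B_def)
      then have "real (card {i \<in> B. T \<subseteq> E i - {u}}) \<le> W * wt (insert u T)"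
        using deg_le[of "insert u T"] by simp
      then show ?thesis using 1 w unfolding deg' by (simp add: mult_ac)
    next
      case False
      then have p: "p = 1" unfolding p_def by simp
      \<comment> \<open>At the cap the original degree bound suffices, as a link is a subset of its
        edge.\<close>
      have "real (deg (J \<union> B) ?E' T) \<le> real (deg I E T)"
        unfolding of_nat_le_iff by (rule deg_mono[OF finite_I sub]) auto
      also have "\<dots> \<le> W * wt T" using deg_le[OF T] .
      also have "\<dots> \<le> 2 * p * W * wt T" using p W_pos wt_nonneg[of T] by simp
      finally show ?thesis .
    qed
  qed
  have "real (Suc y) * real (card I) = real y * real (card I) + real (card I)" by (simp add: algebra_simps)
  also have "\<dots> \<le> 2 * cover_size c * real (card J) + 2 * (cover_size c * real (deg A E {u}))"
    using st(10) A pop by linarith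
  also have "\<dots> = 2 * cover_size c * real (card (J \<union> B))"
    using card_Un_disjoint[OF fin(2,3) disj] unfolding deg_def B_def by (simp add: algebra_simps)
  finally have count: "real (Suc y) * real (card I) \<le> 2 * cover_size c * real (card (J \<union> B))" .
  have cover: "E i \<inter> Z \<noteq> {} \<or> (\<exists>T. heavy (J \<union> B) q' T \<and> T \<subseteq> E i)"
    if "i \<in> I - {i \<in> A. u \<notin> E i \<and> (\<forall>T. heavy (J \<union> B) q' T \<longrightarrow> \<not> T \<subseteq> E i)} - (J \<union> B)" for i
  proof (cases "i \<in> A")
    case True
    then show ?thesis using that unfolding B_def by blast
  next
    case False
    then have "E i \<inter> Z \<noteq> {} \<or> (\<exists>T. heavy J q T \<and> T \<subseteq> E i)" using that st(8)[of i] by blast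
    then show ?thesis using heavy_mono by blast
  qed
  have "q' i \<in> E i \<and> snd (q' i) = c" if "i \<in> J \<union> B" for i
    using that st(5,6) u unfolding q'_def B_def by auto
  moreover have "{i \<in> A. u \<notin> E i \<and> (\<forall>T. heavy (J \<union> B) q' T \<longrightarrow> \<not> T \<subseteq> E i)} \<inter> (J \<union> B) = {}"
    using st(3) unfolding B_def by blast
  ultimately show ?thesis unfolding state_def
    using st(1,4) sub bound count cover by (intro conjI ballI allI impI) (assumption | blast)+
qed

text \<open>Passing from \<open>s\<close> to \<open>s - 1\<close> replaces \<open>W\<close> by
  \<open>2 * p * W\<close> and keeps at least a fraction \<open>p / 2 ^ (s + 1)\<close> of the
  edges. The exponent \<open>s * (s + 1)\<close> drops by \<open>2 * s\<close>, which covers the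
  required \<open>1 + (s + 1)\<close> since \<open>s \<ge> 2\<close>.\<close>

lemma balanced_link:
  assumes st: "state A J q y Z" and J: "p * real (card I) / 2 ^ (s + 1) \<le> real (card J)"
  shows "balanced (\<kappa>(c := \<kappa> c - 1)) (2 * p * W) J (\<lambda>i. E i - {q i})"
proof -
  note st = stateD[OF st]
  let ?\<kappa> = "\<kappa>(c := \<kappa> c - 1)"
  have s': "?\<kappa> False + ?\<kappa> True = s - 1" using \<kappa>_pos unfolding s_def by (cases c) auto
  have finJ: "finite J" using st(2) finite_I finite_subset by blast
  have "p * real (card I) / 2 ^ (s + 1) > 0" using p_pos card_I by simp
  then have "card J > 0" using J by linarith
  then have "J \<noteq> {}" by auto
  have edges: "E i - {q i} \<subseteq> V \<times> UNIV \<and> (\<forall>c'. sz c' (E i - {q i}) = ?\<kappa> c')" if i: "i \<in> J" for i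
  proof -
    have iI: "i \<in> I" and qi: "q i \<in> E i" "snd (q i) = c" using st(2,5,6) i by auto
    have "insert (q i) (E i - {q i}) = E i" using qi by auto
    then have "\<kappa> c' = sz c' (E i - {q i}) + (if c = c' then 1 else 0)" for c'
      using sz_insert[of "E i - {q i}" "q i" c'] finite_E[OF iI] qi sz_E[OF iI, of c'] by simp
    then have "sz c' (E i - {q i}) = ?\<kappa> c'" for c' by (cases "c' = c") auto
    then show ?thesis using E_sub[OF iI] by auto
  qed
  obtain n where n: "s = Suc (Suc n)" using s_ge by (metis Suc_le_D numeral_2_eq_2 Suc_le_mono)
  have "\<delta> * 2 ^ ((s - 1) * (s - 1 + 1)) * (2 * p * W) \<le> p / 2 ^ (s + 1) * (\<delta> * 2 ^ (s * (s + 1)) * W)"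
  proof -
    have "(2::real) ^ ((s - 1) * (s - 1 + 1)) * 2 * 2 ^ (s + 1) = 2 ^ ((s - 1) * (s - 1 + 1) + 1 + (s + 1))"
      by (simp add: power_add)
    also have "\<dots> \<le> 2 ^ (s * (s + 1))" by (intro power_increasing) (simp_all add: n algebra_simps)
    finally have "(2::real) ^ ((s - 1) * (s - 1 + 1)) * 2 \<le> 2 ^ (s * (s + 1)) / 2 ^ (s + 1)"
      by (simp add: pos_le_divide_eq)
    then have "(\<delta> * p * W) * (2 ^ ((s - 1) * (s - 1 + 1)) * 2) \<le> (\<delta> * p * W) * (2 ^ (s * (s + 1)) / 2 ^ (s + 1))"
      using \<delta>_pos p_pos W_pos by (intro mult_left_mono) auto
    then show ?thesis by (simp add: mult_ac)
  qed
  also have "\<dots> \<le> p / 2 ^ (s + 1) * real (card I)" using large p_pos by (intro mult_left_mono) auto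
  also have "\<dots> \<le> real (card J)" using J by simp
  finally have "\<delta> * 2 ^ ((s - 1) * (s - 1 + 1)) * (2 * p * W) \<le> real (card J)" .
  then show ?thesis unfolding balanced_def s'
    using finJ \<open>J \<noteq> {}\<close> edges st(9) p_pos W_pos by simp
qed

text \<open>Induction on the number of available edges: either answer removes all those containing
  the query. The assumption on \<open>q\<close> says that the collecting literals are true in
  \<open>X\<close>; \<open>y\<close> and \<open>Z\<close> account for the answers given before this
  state.\<close>

lemma exists_tree_from_state:
  assumes IH: "\<And>W' J (E' :: 'i \<Rightarrow> ('a \<times> bool) set). balanced (\<kappa>(c := \<kappa> c - 1)) W' J E' \<Longrightarrow>
      \<exists>t. \<forall>X. free J E' X \<longrightarrow> good (\<kappa>(c := \<kappa> c - 1)) t X"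
    and st: "state A J q y Z" and "y \<le> b"
  shows "\<exists>t. \<forall>X. free I E X \<longrightarrow> q ` J \<subseteq> X \<longrightarrow>
     no_set t X \<subseteq> V \<times> UNIV \<and> (\<forall>c'. sz c' (yes_set t X) + (if c' = c then y else 0) \<le> \<kappa> c' * b) \<and>
     (\<exists>c'. \<kappa> c' > 0 \<and> \<delta> * scale c' \<le> real (sz c' (Z \<union> no_set t X)))"
  using st \<open>y \<le> b\<close>
proof (induction "card A" arbitrary: A J q y Z rule: less_induct)
  case less
  note st = \<open>state A J q y Z\<close>
  note std = stateD[OF st]
  have finZ: "finite Z" using std(4) finite_V by (auto intro: finite_subset)
  have yb: "y \<le> \<kappa> c * b" using less.prems(2) \<kappa>_pos by (metis Suc_leI le_trans mult_le_mono1 nat_mult_1 One_nat_def)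
  consider (stop) "p * real (card I) / 2 ^ (s + 1) \<le> real (card J)" | (big) "\<delta> * scale c \<le> real (card Z)"
    | (vac) "\<not> (\<exists>X. free I E X)"
    | (step) "real (card J) < p * real (card I) / 2 ^ (s + 1)" "real (card Z) < \<delta> * scale c" "\<exists>X. free I E X"
    by (meson not_le)
  then show ?case
  proof cases
    case stop
    let ?\<kappa> = "\<kappa>(c := \<kappa> c - 1)"
    obtain t where t: "\<And>X. free J (\<lambda>i. E i - {q i}) X \<Longrightarrow> good ?\<kappa> t X"
      using IH[OF balanced_link[OF st stop]] by blast
    show ?thesis
    proof (intro exI[of _ t] allI impI)
      fix X assume X: "free I E X" "q ` J \<subseteq> X"
      \<comment> \<open>Since \<open>q i\<close> is in \<open>X\<close>, a link inside
        \<open>X\<close> would put its whole edge inside \<open>X\<close>.\<close>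
      have "free J (\<lambda>i. E i - {q i}) X" using X std(2) unfolding free_def by blast
      then have g: "good ?\<kappa> t X" by (rule t)
      have "sz c' (yes_set t X) + (if c' = c then y else 0) \<le> \<kappa> c' * b" for c'
      proof (cases "c' = c")
        case True
        have "sz c (yes_set t X) \<le> ?\<kappa> c * b" using g unfolding good_def by blast
        \<comment> \<open>The recursion uses at most \<open>(\<kappa> c - 1) * b\<close> positive
          answers of side \<open>c\<close>, leaving \<open>b\<close> for this phase.\<close>
        moreover have "(\<kappa> c - 1) * b + b = \<kappa> c * b" using \<kappa>_pos by (cases "\<kappa> c") auto
        ultimately show ?thesis using True less.prems(2) by auto
      next
        case False
        have "sz c' (yes_set t X) \<le> ?\<kappa> c' * b" using g unfolding good_def by blast
        then show ?thesis using False by simp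
      qed
      moreover obtain c' where c': "?\<kappa> c' > 0" "\<delta> * scale c' \<le> real (sz c' (no_set t X))"
        using g unfolding good_def by blast
      have "\<kappa> c' > 0" using c'(1) by (cases "c' = c") auto
      moreover have "real (sz c' (no_set t X)) \<le> real (sz c' (Z \<union> no_set t X))"
        unfolding of_nat_le_iff by (rule sz_mono) (use finZ in auto)
      moreover have "no_set t X \<subseteq> V \<times> UNIV" using g unfolding good_def by blast
      ultimately show "no_set t X \<subseteq> V \<times> UNIV \<and>
        (\<forall>c'. sz c' (yes_set t X) + (if c' = c then y else 0) \<le> \<kappa> c' * b) \<and>
        (\<exists>c'. \<kappa> c' > 0 \<and> \<delta> * scale c' \<le> real (sz c' (Z \<union> no_set t X)))"
        using c'(2) by fastforce
    qed
  next
    case big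
    have "sz c Z = card Z" using std(4) by (intro sz_eq_card) auto
    then show ?thesis using big yb \<kappa>_pos by (intro exI[of _ Leaf]) (auto simp: sz_def)
  next
    \<comment> \<open>No set has to be served, so any tree will do.\<close>
    case vac
    then show ?thesis by blast
  next
    case step
    have A: "real (card I) \<le> 2 * real (card A)" by (rule available_large[OF st step(1,2)])
    then have "A \<noteq> {}" using card_I by auto
    then obtain u where u: "u \<in> V \<times> {c}" and pop: "real (card A) \<le> cover_size c * real (deg A E {u})"
      using exists_popular std(1) step(3) by blast
    have finA: "finite A" using std(1) finite_I finite_subset by blast
    have "card A > 0" using finA \<open>A \<noteq> {}\<close> by (simp add: card_gt_0_iff)
    then have "deg A E {u} \<noteq> 0" using pop by (intro notI) simp
    then have "{i \<in> A. {u} \<subseteq> E i} \<noteq> {}" unfolding deg_def by (metis card.empty)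
    then obtain i where i: "i \<in> A" "u \<in> E i" by blast
    \<comment> \<open>After \<open>b\<close> positive answers at least \<open>p * card I / 2\<close>
      links are collected, which already falls under \<open>stop\<close>.\<close>
    have yb': "Suc y \<le> b"
    proof (rule ccontr)
      assume "\<not> Suc y \<le> b"
      then have "y = b" using less.prems(2) by simp
      then have "real b * real (card I) \<le> 2 * cover_size c * real (card J)" using std(10) by blast
      then have "real b / cover_size c * real (card I) \<le> 2 * real (card J)"
        using cover_size_pos[of c] by (simp add: field_simps)
      moreover have "p * real (card I) \<le> real b / cover_size c * real (card I)"
        using p_le by (intro mult_right_mono) auto
      ultimately have "p * real (card I) / 2 \<le> real (card J)" by simp
      moreover have "p * real (card I) / 2 ^ (s + 1) \<le> p * real (card I) / 2 ^ 1"
        using p_pos by (intro divide_left_mono power_increasing) auto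
      ultimately show False using step(1) by simp
    qed
    define B where "B = {i \<in> A. u \<in> E i}"
    define q' where "q' = (\<lambda>i. if i \<in> B then u else q i)"
    define A1 where "A1 = {i \<in> A. u \<notin> E i \<and> (\<forall>T. heavy (J \<union> B) q' T \<longrightarrow> \<not> T \<subseteq> E i)}"
    define A0 where "A0 = {i \<in> A. u \<notin> E i}"
    have st1: "state A1 (J \<union> B) q' (Suc y) Z"
      using state_yes[OF st u pop A] unfolding A1_def B_def q'_def .
    have st0: "state A0 J q y (insert u Z)"
      using state_no[OF st u] unfolding A0_def .
    have "card A1 < card A" "card A0 < card A"
      using i finA unfolding A1_def A0_def by (auto intro!: psubset_card_mono)
    note IH1 = less.hyps[OF \<open>card A1 < card A\<close> st1 yb'] and IH0 = less.hyps[OF \<open>card A0 < card A\<close> st0 less.prems(2)]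
    obtain t1 where t1: "\<And>X. free I E X \<Longrightarrow> q' ` (J \<union> B) \<subseteq> X \<Longrightarrow>
       no_set t1 X \<subseteq> V \<times> UNIV \<and> (\<forall>c'. sz c' (yes_set t1 X) + (if c' = c then Suc y else 0) \<le> \<kappa> c' * b) \<and>
       (\<exists>c'. \<kappa> c' > 0 \<and> \<delta> * scale c' \<le> real (sz c' (Z \<union> no_set t1 X)))"
      using IH1 by blast
    obtain t0 where t0: "\<And>X. free I E X \<Longrightarrow> q ` J \<subseteq> X \<Longrightarrow>
       no_set t0 X \<subseteq> V \<times> UNIV \<and> (\<forall>c'. sz c' (yes_set t0 X) + (if c' = c then y else 0) \<le> \<kappa> c' * b) \<and>
       (\<exists>c'. \<kappa> c' > 0 \<and> \<delta> * scale c' \<le> real (sz c' (insert u Z \<union> no_set t0 X)))"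
      using IH0 by blast
    show ?thesis
    proof (intro exI[of _ "Query u t1 t0"] allI impI)
      fix X assume X: "free I E X" "q ` J \<subseteq> X"
      show "no_set (Query u t1 t0) X \<subseteq> V \<times> UNIV \<and>
        (\<forall>c'. sz c' (yes_set (Query u t1 t0) X) + (if c' = c then y else 0) \<le> \<kappa> c' * b) \<and>
        (\<exists>c'. \<kappa> c' > 0 \<and> \<delta> * scale c' \<le> real (sz c' (Z \<union> no_set (Query u t1 t0) X)))"
      proof (cases "u \<in> X")
        case True
        then have "q' ` (J \<union> B) \<subseteq> X" using X(2) unfolding q'_def by auto
        note t = t1[OF X(1) this]
        have "sz c' (insert u (yes_set t1 X)) + (if c' = c then y else 0) \<le> \<kappa> c' * b" for c'
        proof -
          have "sz c' (insert u (yes_set t1 X)) \<le> sz c' (yes_set t1 X) + (if c' = c then 1 else 0)"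
            using sz_insert_le[of "yes_set t1 X" c' u] u by auto
          moreover have "sz c' (yes_set t1 X) + (if c' = c then Suc y else 0) \<le> \<kappa> c' * b" using t by blast
          ultimately show ?thesis by (cases "c' = c") auto
        qed
        then show ?thesis using t True by simp
      next
        case False
        then show ?thesis using t0[OF X] u by auto
      qed
    qed
  qed
qed

end

section \<open>Induction on the uniformity\<close>

context container
begin

lemma exists_good_tree:
  fixes E :: "'i \<Rightarrow> ('a \<times> bool) set"
  assumes "balanced \<kappa> W I E" "\<kappa> False + \<kappa> True > 0" "b > 0 \<or> \<kappa> False + \<kappa> True = 1"
  shows "\<exists>t. \<forall>X. free I E X \<longrightarrow> good \<kappa> t X"
  using assms
proof (induction "\<kappa> False + \<kappa> True" arbitrary: \<kappa> W I E rule: less_induct)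
  case less
  show ?case
  proof (cases "\<kappa> False + \<kappa> True = 1")
    case True
    then show ?thesis using balanced_base less.prems(1) by blast
  next
    case False
    \<comment> \<open>0-literals are queried only when the edges contain no 1-literal, as
      \<open>side\<close> demands.\<close>
    define c where "c = (\<kappa> True > 0)"
    interpret phase V b m r \<delta> I E \<kappa> W c
      by unfold_locales (use less.prems False in \<open>cases "\<kappa> True = 0"; force simp: c_def\<close>)+
    have "(\<kappa>(c := \<kappa> c - 1)) False + (\<kappa>(c := \<kappa> c - 1)) True = s - 1"
      using \<kappa>_pos unfolding s_def by (cases c) auto
    then have IH: "\<exists>t. \<forall>X. free J E' X \<longrightarrow> good (\<kappa>(c := \<kappa> c - 1)) t X"
      if "balanced (\<kappa>(c := \<kappa> c - 1)) W' J E'" for W' J and E' :: "'i \<Rightarrow> ('a \<times> bool) set"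
      using less.hyps[OF _ that] s_ge b_pos unfolding s_def by simp
    \<comment> \<open>At the start nothing is collected, and since weights are positive no set is
      heavy.\<close>
    have "state I {} (\<lambda>i. undefined) 0 {}"
    proof -
      have "deg {} E' T = 0" for E' :: "'i \<Rightarrow> ('a \<times> bool) set" and T unfolding deg_def by simp
      moreover have "p * W * wt T > 0" "2 * p * W * wt T > 0" for T
        using p_pos W_pos wt_pos[OF b_pos] by simp_all
      ultimately show ?thesis unfolding state_def heavy_def
        by (simp add: not_le[symmetric] less_imp_le)
    qed
    from exists_tree_from_state[OF IH this] show ?thesis
      unfolding good_def by simp
  qed
qed

end

section \<open>From multisets of pairs to indexed sets of literals\<close>

definition lits :: "'a set \<Rightarrow> 'a set \<Rightarrow> ('a \<times> bool) set" where
  "lits A0 A1 = A0 \<times> {False} \<union> A1 \<times> {True}"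

lemma sz_lits: "sz c (lits A0 A1) = (if c then card A1 else card A0)"
proof -
  have "{x \<in> lits A0 A1. snd x = c} = (if c then A1 \<times> {True} else A0 \<times> {False})"
    unfolding lits_def by auto
  then show ?thesis unfolding sz_def by (simp add: card_cartesian_product)
qed

lemma lits_subset_iff: "lits A0 A1 \<subseteq> lits B0 B1 \<longleftrightarrow> A0 \<subseteq> B0 \<and> A1 \<subseteq> B1"
  unfolding lits_def by auto

lemma lits_surj: "T = lits {v. (v, False) \<in> T} {v. (v, True) \<in> T}"
proof (rule set_eqI)
  fix x :: "'a \<times> bool"
  show "x \<in> T \<longleftrightarrow> x \<in> lits {v. (v, False) \<in> T} {v. (v, True) \<in> T}"
    by (cases x; cases "snd x") (auto simp: lits_def)
qed

text \<open>Positions in a list enumerating the multiset serve as edge indices, which preserves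
  multiplicities.\<close>

lemma hdeg_mset:
  "hdeg (mset xs) T0 T1 = deg {..<length xs} (\<lambda>i. lits (fst (xs ! i)) (snd (xs ! i))) (lits T0 T1)"
proof -
  have "hdeg (mset xs) T0 T1 = length (filter (\<lambda>(A0, A1). T0 \<subseteq> A0 \<and> T1 \<subseteq> A1) xs)"
    unfolding hdeg_def by (metis mset_filter size_mset)
  also have "\<dots> = card {i. i < length xs \<and> (\<lambda>(A0, A1). T0 \<subseteq> A0 \<and> T1 \<subseteq> A1) (xs ! i)}"
    by (rule length_filter_conv_card)
  finally show ?thesis unfolding deg_def lits_subset_iff by (simp add: case_prod_beta)
qed

lemma hdeg_le_max_hdeg:
  assumes "finite V" "T0 \<subseteq> V" "T1 \<subseteq> V"
  shows "hdeg H T0 T1 \<le> max_hdeg (card T0) (card T1) V H"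
proof -
  let ?D = "{hdeg H S0 S1 | S0 S1. S0 \<subseteq> V \<and> S1 \<subseteq> V \<and> card S0 = card T0 \<and> card S1 = card T1}"
  have "?D \<subseteq> (\<lambda>(S0, S1). hdeg H S0 S1) ` (Pow V \<times> Pow V)" by auto
  then have "finite ?D" by (rule finite_subset) (use assms(1) in simp)
  then show ?thesis unfolding max_hdeg_def using assms by (intro Max_ge) auto
qed

section \<open>Fingerprints and cylinders from the tree\<close>

theorem theorem1p4:
  fixes V :: "'a set" and H :: "'a hyp" and k0 k1 :: nat and b m r :: int and K \<delta> :: real
  assumes "(k0, k1) \<noteq> (0, 0)" and "K > 0"
    and "uniform_hypergraph k0 k1 V H" and "H \<noteq> {#}"
    and "b \<ge> 0" and "r > 0"
    and "\<And>l0 l1. l0 \<in> {0..k0} \<Longrightarrow> l1 \<in> {0..k1} \<Longrightarrow> (l0, l1) \<noteq> (0, 0) \<Longrightarrow>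
           real (max_hdeg l0 l1 V H) \<le>
             K * (real_of_int b ^ (l0 + l1 - 1) / (real_of_int m ^ l0 * real (card V) ^ l1))
               * real (size H) * (real_of_int m / real_of_int r) ^ (if l0 > 0 then 1 else 0)"
    and "\<delta> = 1 / 2 ^ ((k0 + k1) * (k0 + k1 + 1)) * (1 / K)"
  shows "\<exists>\<S> f g.
           \<S> \<subseteq> subsets_le V (int k0 * b) \<times> subsets_le V (int k1 * b) \<and>
           f \<in> \<S> \<rightarrow> cylinders V \<and>
           g \<in> free_funs_le m V H \<rightarrow> \<S> \<and>
           (\<forall>h \<in> free_funs_le m V H. in_cylinder V h (f (g h))) \<and>
           (\<forall>S \<in> \<S>.
              (real (card (preimage_on V (f S) (Some 0))) \<ge> \<delta> * real (card V) \<or>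
               real (card (preimage_on V (f S) (Some 1))) \<ge> \<delta> * real_of_int r) \<and>
              (real (card (preimage_on V (f S) (Some 0))) \<ge> \<delta> * real (card V) \<longrightarrow> k1 > 0) \<and>
              (real (card (preimage_on V (f S) (Some 1))) \<ge> \<delta> * real_of_int r \<longrightarrow> k0 > 0)) \<and>
           (\<forall>h \<in> free_funs_le m V H. \<forall>S0 S1. g h = (S0, S1) \<longrightarrow>
              S0 \<subseteq> preimage_on V h 0 \<and> S1 \<subseteq> preimage_on V h 1)"
proof (cases "m < 0")
  case True
  \<comment> \<open>For negative \<open>m\<close> there is no \<open>h\<close>, and the empty family
    works.\<close>
  then have "free_funs_le m V H = {}" unfolding free_funs_le_def by auto
  then show ?thesis by (intro exI[of _ "{}"]) auto
next
  case False
  note maxdeg = assms(7) and \<delta>_def = assms(8)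
  have finV: "finite V" and unif: "\<And>A0 A1. (A0, A1) \<in># H \<Longrightarrow>
      A0 \<subseteq> V \<and> A1 \<subseteq> V \<and> A0 \<inter> A1 = {} \<and> card A0 = k0 \<and> card A1 = k1"
    using assms(3) unfolding uniform_hypergraph_def by auto
  obtain xs where xs: "mset xs = H" using ex_mset by blast
  define I where "I = {..<length xs}"
  define E where "E = (\<lambda>i. lits (fst (xs ! i)) (snd (xs ! i)))"
  have E_in: "(fst (xs ! i), snd (xs ! i)) \<in># H" if "i \<in> I" for i
    using that xs nth_mem[of i xs] unfolding I_def by (auto simp flip: xs)
  have hdeg_eq: "hdeg H T0 T1 = deg I E (lits T0 T1)" for T0 T1
    using hdeg_mset[of xs] unfolding xs I_def E_def .
  have cardI: "card I = size H" unfolding I_def by (simp flip: xs)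
  have finI: "finite I" unfolding I_def by simp
  have H_pos: "size H > 0" using assms(4) by (simp add: nonempty_has_size)
  obtain A0 A1 where A: "(A0, A1) \<in># H" using assms(4) by (metis multiset_nonemptyE surj_pair)
  have cardV: "card V > 0"
  proof -
    have "A0 \<noteq> {} \<or> A1 \<noteq> {}" using unif[OF A] assms(1) by auto
    then show ?thesis using unif[OF A] finV by (auto simp: card_gt_0_iff)
  qed
  \<comment> \<open>An edge has positive degree, so the right-hand side of the hypothesis at
    \<open>(k0, k1)\<close> is positive. This forces \<open>m > 0\<close> if \<open>k0 > 0\<close>,
    and \<open>b > 0\<close> unless \<open>k0 + k1 = 1\<close>.\<close>
  have full: "max_hdeg k0 k1 V H > 0"
  proof -
    have "(A0, A1) \<in># filter_mset (\<lambda>(B0, B1). A0 \<subseteq> B0 \<and> A1 \<subseteq> B1) H" using A by simp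
    then have "hdeg H A0 A1 > 0" unfolding hdeg_def by (metis nonempty_has_size empty_iff set_mset_empty)
    moreover have "hdeg H A0 A1 \<le> max_hdeg k0 k1 V H" using hdeg_le_max_hdeg[OF finV, of A0 A1] unif[OF A] by auto
    ultimately show ?thesis by simp
  qed
  have m_pos: "m > 0" if "k0 > 0"
  proof (rule ccontr)
    assume "\<not> m > 0"
    then have "m = 0" using False by simp
    then show False using maxdeg[of k0 k1] full that by simp
  qed
  have b_pos: "b > 0" if "k0 + k1 \<noteq> 1"
  proof (rule ccontr)
    assume "\<not> b > 0"
    then have "b = 0" using assms(5) by simp
    moreover have "k0 + k1 - 1 > 0" using that assms(1) by auto
    ultimately have "real_of_int b ^ (k0 + k1 - 1) = 0" by (metis of_int_0 zero_power)
    then have "real (max_hdeg k0 k1 V H) \<le> 0" using maxdeg[of k0 k1] assms(1) by (simp only:) simp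
    then show False using full by simp
  qed
  \<comment> \<open>When \<open>k0 = 0\<close>, \<open>m = 0\<close> is possible. Raising it to 1
    gives the positivity demanded by \<open>container\<close>, and weights of sets without
    0-literals do not depend on it.\<close>
  define b' m' r' where "b' = nat b" and "m' = nat (max m 1)" and "r' = nat r"
  have b': "real b' = real_of_int b" "int b' = b" and r': "real r' = real_of_int r"
    unfolding b'_def r'_def using assms(5,6) by auto
  have m': "real m' = real_of_int m" if "k0 > 0" unfolding m'_def using m_pos[OF that] by simp
  interpret container V b' m' r' \<delta>
    by unfold_locales (use finV cardV assms(2,6) in \<open>auto simp: m'_def r'_def \<delta>_def\<close>)
  define \<kappa> where "\<kappa> = (\<lambda>c. if c then k1 else k0)"
  have wt_eq: "wt T = real_of_int b ^ (sz False T + sz True T - 1) /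
      (real_of_int m ^ sz False T * real (card V) ^ sz True T) *
      (real_of_int m / real_of_int r) ^ (if sz False T > 0 then 1 else 0)" if "sz False T \<le> k0" for T
  proof (cases "sz False T")
    case 0
    then show ?thesis unfolding wt_def b' by simp
  next
    case (Suc l)
    then show ?thesis using m' m_pos that unfolding wt_def b' r' by (simp add: field_simps)
  qed
  \<comment> \<open>With \<open>W = K * e(H)\<close> the last inequality of \<open>balanced\<close>
    is an equality, by the choice of \<open>\<delta>\<close>.\<close>
  have bal: "balanced \<kappa> (K * real (size H)) I E"
    unfolding balanced_def
  proof (intro conjI allI impI ballI)
    show "finite I" by (rule finI)
    show "I \<noteq> {}" using cardI H_pos by auto
    show "K * real (size H) > 0" using assms(2) H_pos by simp
    show "\<delta> * 2 ^ ((\<kappa> False + \<kappa> True) * (\<kappa> False + \<kappa> True + 1)) * (K * real (size H)) \<le> real (card I)"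
      unfolding \<delta>_def \<kappa>_def cardI using assms(2) by simp
    show "E i \<subseteq> V \<times> UNIV" if "i \<in> I" for i
      using unif[OF E_in[OF that]] unfolding E_def lits_def by auto
    show "sz c (E i) = \<kappa> c" if "i \<in> I" for i c
      using unif[OF E_in[OF that]] unfolding E_def sz_lits \<kappa>_def by auto
    fix T :: "('a \<times> bool) set" assume T: "T \<noteq> {}"
    show "real (deg I E T) \<le> K * real (size H) * wt T"
    \<comment> \<open>A set of non-zero degree lies in an edge, so it is finite and its sizes are in
      the range of the hypothesis.\<close>
    proof (cases "deg I E T = 0")
      case True
      then show ?thesis using wt_nonneg[of T] assms(2) by simp
    next
      case False
      then have "{i \<in> I. T \<subseteq> E i} \<noteq> {}" unfolding deg_def by (metis card.empty)
      then obtain i where i: "i \<in> I" "T \<subseteq> E i" by blast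
      define T0 T1 where "T0 = {v. (v, False) \<in> T}" and "T1 = {v. (v, True) \<in> T}"
      have TT: "T = lits T0 T1" unfolding T0_def T1_def by (rule lits_surj)
      then have sub: "T0 \<subseteq> fst (xs ! i)" "T1 \<subseteq> snd (xs ! i)"
        using i(2) unfolding E_def by (simp_all add: lits_subset_iff)
      note e = unif[OF E_in[OF i(1)]]
      have TV: "T0 \<subseteq> V" "T1 \<subseteq> V" using sub e by auto
      have fin: "finite T0" "finite T1" using TV finV finite_subset by auto
      have le: "card T0 \<le> k0" "card T1 \<le> k1"
        using sub e finV by (metis card_mono finite_subset)+
      have ne: "(card T0, card T1) \<noteq> (0, 0)" using T TT fin by (auto simp: lits_def)
      have "real (deg I E T) \<le> real (max_hdeg (card T0) (card T1) V H)"
        using hdeg_le_max_hdeg[OF finV TV, of H] unfolding hdeg_eq TT by simp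
      also have "\<dots> \<le> K * real (size H) * wt T"
        using maxdeg[OF _ _ ne] le wt_eq[of T] unfolding TT sz_lits by (simp add: mult_ac)
      finally show ?thesis .
    qed
  qed
  obtain t where t: "\<And>X. free I E X \<Longrightarrow> good \<kappa> t X"
    using exists_good_tree[OF bal] assms(1) b_pos unfolding \<kappa>_def b'_def by auto
  define X where "X = (\<lambda>h :: 'a \<Rightarrow> nat. lits (preimage_on V h 0) (preimage_on V h 1))"
  \<comment> \<open>Intersecting with the preimages makes (c) immediate; nothing is lost, since
    positive answers are literals true in \<open>h\<close>.\<close>
  define g where "g = (\<lambda>h. (preimage_on V h 0 \<inter> {v. (v, False) \<in> yes_set t (X h)},
                          preimage_on V h 1 \<inter> {v. (v, True) \<in> yes_set t (X h)}))"
  \<comment> \<open>A false 1-literal gives the value 0, a false 0-literal the value 1. If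
    \<open>k1 = 0\<close> or \<open>k0 = 0\<close>, the guard keeps the corresponding preimage
    empty; as the thresholds in (b) are positive, this yields its second half.\<close>
  define f where "f = (\<lambda>S. \<lambda>v\<in>V.
      if k1 > 0 \<and> (v, True) \<in> no_set t (lits (fst S) (snd S)) then Some 0
      else if k0 > 0 \<and> (v, False) \<in> no_set t (lits (fst S) (snd S)) then Some 1 else (None :: nat option))"
  have g_lits: "lits (fst (g h)) (snd (g h)) = yes_set t (X h)" for h
    using yes_set_subset[of t "X h"] unfolding g_def X_def lits_def by auto
  have X_mem: "(v, True) \<in> X h \<longleftrightarrow> h v = 1" "(v, False) \<in> X h \<longleftrightarrow> h v = 0" if "v \<in> V" for h v
    using that unfolding X_def lits_def preimage_on_def by auto
  have f_g: "f (g h) v = (if k1 > 0 \<and> (v, True) \<in> no_set t (X h) then Some 0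
      else if k0 > 0 \<and> (v, False) \<in> no_set t (X h) then Some 1 else None)" if "v \<in> V" for h v
    using that unfolding f_def g_lits no_set_yes_set by simp
  have h01: "h v = 0 \<or> h v = 1" if "h \<in> free_funs_le m V H" "v \<in> V" for h v
    using that unfolding free_funs_le_def free_funs_def by (auto simp: PiE_iff)
  have good: "good \<kappa> t (X h)" if h: "h \<in> free_funs_le m V H" for h
  proof (rule t)
    have "V \<times> {False} - X h = preimage_on V h 1 \<times> {False}"
      using X_mem h01[OF h] unfolding preimage_on_def by fastforce
    then have "card (V \<times> {False} - X h) = card (preimage_on V h 1)" by (simp add: card_cartesian_product)
    moreover have "int (card (preimage_on V h 1)) \<le> m" using h unfolding free_funs_le_def by simp
    ultimately have "card (V \<times> {False} - X h) \<le> m'" unfolding m'_def by linarith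
    moreover have "\<not> E i \<subseteq> X h" if i: "i \<in> I" for i
    proof
      assume "E i \<subseteq> X h"
      then have "violates h (fst (xs ! i), snd (xs ! i))"
        unfolding E_def X_def lits_subset_iff violates_def preimage_on_def by auto
      then show False using h E_in[OF i] unfolding free_funs_le_def free_funs_def by blast
    qed
    ultimately show "free I E (X h)" unfolding free_def by blast
  qed
  have no_mem: "(v, True) \<in> no_set t (X h) \<Longrightarrow> h v = 0" "(v, False) \<in> no_set t (X h) \<Longrightarrow> h v = 1"
    if "h \<in> free_funs_le m V H" "v \<in> V" for h v
  proof -
    have "(v, d) \<notin> X h" if "(v, d) \<in> no_set t (X h)" for d
      using no_set_disjoint[of t "X h"] that by blast
    then show "(v, True) \<in> no_set t (X h) \<Longrightarrow> h v = 0" "(v, False) \<in> no_set t (X h) \<Longrightarrow> h v = 1"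
      using X_mem[OF that(2), of h] h01[OF that] by metis+
  qed
  have no_sub: "no_set t (X h) \<subseteq> V \<times> UNIV" if "h \<in> free_funs_le m V H" for h
    using good[OF that] unfolding good_def by blast
  have pre: "preimage_on V (f (g h)) (Some 0) = (if k1 > 0 then {v. (v, True) \<in> no_set t (X h)} else {})"
    "preimage_on V (f (g h)) (Some 1) = (if k0 > 0 then {v. (v, False) \<in> no_set t (X h)} else {})"
    if h: "h \<in> free_funs_le m V H" for h
  proof -
    have V_mem: "v \<in> V" if "(v, d) \<in> no_set t (X h)" for v d using no_sub[OF h] that by blast
    then show "preimage_on V (f (g h)) (Some 0) = (if k1 > 0 then {v. (v, True) \<in> no_set t (X h)} else {})"
      unfolding preimage_on_def by (auto simp: f_g split: if_splits)
    \<comment> \<open>The two literals at \<open>v\<close> are never both false, so the first branch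
      of \<open>f\<close> does not hide the second.\<close>
    have "(v, True) \<notin> no_set t (X h)" if "(v, False) \<in> no_set t (X h)" for v
      using no_mem[OF h V_mem[OF that]] that by auto
    then show "preimage_on V (f (g h)) (Some 1) = (if k0 > 0 then {v. (v, False) \<in> no_set t (X h)} else {})"
      using V_mem unfolding preimage_on_def by (auto simp: f_g split: if_splits)
  qed
  have sz_no: "sz c (no_set t Y) = card {v. (v, c) \<in> no_set t Y}" for c Y
  proof -
    have "{x \<in> no_set t Y. snd x = c} = {v. (v, c) \<in> no_set t Y} \<times> {c}" by auto
    then show ?thesis unfolding sz_def by (simp add: card_cartesian_product)
  qed
  have pos: "\<delta> * real (card V) > 0" "\<delta> * real_of_int r > 0" using \<delta>_pos cardV assms(6) by auto
  \<comment> \<open>With the image of \<open>g\<close> as the family, (b) has to be verified only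
    for fingerprints of actual functions \<open>h\<close>.\<close>
  let ?F = "free_funs_le m V H"
  have "g ` ?F \<subseteq> subsets_le V (int k0 * b) \<times> subsets_le V (int k1 * b)"
  proof (rule image_subsetI)
    fix h assume h: "h \<in> ?F"
    have le: "sz c (lits (fst (g h)) (snd (g h))) \<le> \<kappa> c * b'" for c
      using good[OF h] unfolding good_def g_lits by blast
    have "card (fst (g h)) \<le> k0 * b'" "card (snd (g h)) \<le> k1 * b'"
      using le[of False] le[of True] by (simp_all add: sz_lits \<kappa>_def)
    then have "int (card (fst (g h))) \<le> int k0 * b" "int (card (snd (g h))) \<le> int k1 * b"
      by (metis b'(2) of_nat_le_iff of_nat_mult)+
    moreover have "fst (g h) \<subseteq> V" "snd (g h) \<subseteq> V" unfolding g_def preimage_on_def by auto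
    ultimately show "g h \<in> subsets_le V (int k0 * b) \<times> subsets_le V (int k1 * b)"
      unfolding subsets_le_def by (simp add: mem_Times_iff)
  qed
  moreover have "f \<in> g ` ?F \<rightarrow> cylinders V" unfolding f_def cylinders_def by auto
  moreover have "g \<in> ?F \<rightarrow> g ` ?F" by auto
  moreover have "\<forall>h\<in>?F. in_cylinder V h (f (g h))"
    unfolding in_cylinder_def using f_g no_mem by auto
  moreover have "\<forall>S\<in>g ` ?F.
      (real (card (preimage_on V (f S) (Some 0))) \<ge> \<delta> * real (card V) \<or>
       real (card (preimage_on V (f S) (Some 1))) \<ge> \<delta> * real_of_int r) \<and>
      (real (card (preimage_on V (f S) (Some 0))) \<ge> \<delta> * real (card V) \<longrightarrow> k1 > 0) \<and>
      (real (card (preimage_on V (f S) (Some 1))) \<ge> \<delta> * real_of_int r \<longrightarrow> k0 > 0)"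
  proof (rule ballI, erule imageE)
    fix S h assume S: "S = g h" and h: "h \<in> ?F"
    obtain c where c: "\<kappa> c > 0" "\<delta> * scale c \<le> real (card {v. (v, c) \<in> no_set t (X h)})"
      using good[OF h] unfolding good_def sz_no by blast
    show "(real (card (preimage_on V (f S) (Some 0))) \<ge> \<delta> * real (card V) \<or>
       real (card (preimage_on V (f S) (Some 1))) \<ge> \<delta> * real_of_int r) \<and>
      (real (card (preimage_on V (f S) (Some 0))) \<ge> \<delta> * real (card V) \<longrightarrow> k1 > 0) \<and>
      (real (card (preimage_on V (f S) (Some 1))) \<ge> \<delta> * real_of_int r \<longrightarrow> k0 > 0)"
      using c pos unfolding S pre[OF h] \<kappa>_def scale_def r' by (cases c) auto
  qed
  moreover have "\<forall>h\<in>?F. \<forall>S0 S1. g h = (S0, S1) \<longrightarrow> S0 \<subseteq> preimage_on V h 0 \<and> S1 \<subseteq> preimage_on V h 1"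
    unfolding g_def by auto
  ultimately show ?thesis by (intro exI[of _ "g ` ?F"] exI[of _ f] exI[of _ g] conjI)
qed

end
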